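(* Let $\eta$ be a Poisson point process in $\mathbb R^d$ with locally finite, non-atomic, non-zero intensity measure (not necessarily finite). Let $F$ be a U-statistic of order $k$ with kernel $f\ge0$ such that $F=F(\eta)$ is almost surely finite and such that for some constants $\rho_F>0$, $\Theta_F\ge1$ and $M_F\ge m_F>0$: (K1) $f(x_1,\dots,x_k)>0$ whenever $\operatorname{diam}(x_1,\dots,x_k)\le\rho_F$; (K2) $f(x_1,\dots,x_k)=0$ whenever $\operatorname{diam}(x_1,\dots,x_k)>\Theta_F\rho_F$; (K3) $M_F\ge f(x_1,\dots,x_k)\ge m_F$ whenever $f(x_1,\dots,x_k)>0$. Let $M$ be either the mean or a median of $F$, and let $I:[0,\infty)\to\mathbb R$ and $a>0$ be such that $$\mathbb P(F\ge M+r)\le\exp(-I(r))\quad\text{for all } r\ge0\qquad\text{and}\qquad\liminf_{r\to\infty}\frac{I(r)}{r^a}>0 .$$ Then $a\le 1/k$.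
   Context: For a locally finite set $\xi\subset\mathbb R^d$, $\xi^k_{\neq}$ is the set of $k$-tuples of pairwise distinct points of $\xi$. A U-statistic of order $k$ with kernel $f$ is the functional $F(\xi)=\sum_{\mathbf x\in\xi^k_{\neq}}f(\mathbf x)$, where $f:(\mathbb R^d)^k\to\mathbb R$ is symmetric and measurable; $F$ also denotes the random variable $F(\eta)$, the process $\eta$ being identified with the random locally finite set of its points. $\operatorname{diam}(x_1,\dots,x_k)$ is the Euclidean diameter of $\{x_1,\dots,x_k\}$. A median of a real random variable $Z$ is a number $m$ with $\mathbb P(Z\le m)\ge1/2$ and $\mathbb P(Z\ge m)\ge1/2$. (The mean of $F$ is finite whenever $\eta$ is a Poisson point process in $\mathbb R^d$ with locally finite, non-atomic, non-zero intensity measure and $F=F(\eta)$ is an almost surely finite U-statistic of order $k$ whose kernel $f\ge0$ satisfies, for some constants $\rho_F>0$, $\Theta_F\ge1$ and $M_F\ge m_F>0$: $f(x_1,\dots,x_k)>0$ if $\operatorname{diam}(x_1,\dots,x_k)\le\rho_F$; $f(x_1,\dots,x_k)=0$ if $\operatorname{diam}(x_1,\dots,x_k)>\Theta_F\rho_F$; and $M_F\ge f(x_1,\dots,x_k)\ge m_F$ if $f(x_1,\dots,x_k)>0$.) *)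

theory Defs
  imports "HOL-Probability.Probability"
begin

definition locally_finite_set :: "'a::metric_space set \<Rightarrow> bool" where
  "locally_finite_set \<xi> \<longleftrightarrow> (\<forall>B. bounded B \<longrightarrow> finite (\<xi> \<inter> B))"

definition locally_finite_measure :: "'a::metric_space measure \<Rightarrow> bool" where
  "locally_finite_measure \<mu> \<longleftrightarrow> (\<forall>B\<in>sets \<mu>. bounded B \<longrightarrow> emeasure \<mu> B < \<infinity>)"

definition atom_of :: "'a measure \<Rightarrow> 'a set \<Rightarrow> bool" where
  "atom_of \<mu> A \<longleftrightarrow> A \<in> sets \<mu> \<and> emeasure \<mu> A > 0 \<and>
     (\<forall>B\<in>sets \<mu>. B \<subseteq> A \<longrightarrow> emeasure \<mu> B = 0 \<or> emeasure \<mu> (A - B) = 0)"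

(* For a locally finite Borel measure on a Euclidean space this says that every point has
   measure 0. *)
definition non_atomic :: "'a measure \<Rightarrow> bool" where
  "non_atomic \<mu> \<longleftrightarrow> (\<nexists>A. atom_of \<mu> A)"

(* The number of points of \<xi> in B, possibly infinite. *)
definition point_count :: "'a set \<Rightarrow> 'a set \<Rightarrow> ennreal" where
  "point_count \<xi> B = emeasure (count_space UNIV) (\<xi> \<inter> B)"

(* The process is given by the random set of its points; this loses nothing, since a Poisson
   process with non-atomic intensity measure almost surely has no multiple points.
   The last clause is independence over every finite family of disjoint Borel sets. *)
definition poisson_point_process ::
  "'w measure \<Rightarrow> ('w \<Rightarrow> 'a::euclidean_space set) \<Rightarrow> 'a measure \<Rightarrow> bool" where
  "poisson_point_process P \<eta> \<mu> \<longleftrightarrow>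
     sets \<mu> = sets borel \<and>
     (\<forall>\<omega>\<in>space P. locally_finite_set (\<eta> \<omega>)) \<and>
     (\<forall>B\<in>sets borel. (\<lambda>\<omega>. point_count (\<eta> \<omega>) B) \<in> borel_measurable P) \<and>
     (\<forall>B\<in>sets borel. emeasure \<mu> B < \<infinity> \<longrightarrow>
        (\<forall>n::nat. measure P {\<omega>\<in>space P. point_count (\<eta> \<omega>) B = of_nat n}
           = exp (- measure \<mu> B) * measure \<mu> B ^ n / fact n)) \<and>
     (\<forall>B\<in>sets borel. emeasure \<mu> B = \<infinity> \<longrightarrow>
        (AE \<omega> in P. point_count (\<eta> \<omega>) B = \<infinity>)) \<and>
     (\<forall>(m::nat) B. (\<forall>i<m. B i \<in> sets borel) \<longrightarrow> disjoint_family_on B {..<m} \<longrightarrow>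
        prob_space.indep_vars P (\<lambda>_. borel) (\<lambda>i \<omega>. point_count (\<eta> \<omega>) (B i)) {..<m})"

(* (R^d)^k: a k-tuple is a function on {..<k}, extended by undefined. *)
abbreviation tuples :: "nat \<Rightarrow> 'a set \<Rightarrow> (nat \<Rightarrow> 'a) set" where
  "tuples k A \<equiv> {..<k} \<rightarrow>\<^sub>E A"

definition distinct_tuples :: "nat \<Rightarrow> 'a set \<Rightarrow> (nat \<Rightarrow> 'a) set" where
  "distinct_tuples k \<xi> = {x \<in> tuples k \<xi>. inj_on x {..<k}}"

definition tuple_diam :: "nat \<Rightarrow> (nat \<Rightarrow> 'a::metric_space) \<Rightarrow> real" where
  "tuple_diam k x = diameter (x ` {..<k})"

definition symmetric_kernel :: "nat \<Rightarrow> ((nat \<Rightarrow> 'a) \<Rightarrow> real) \<Rightarrow> bool" where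
  "symmetric_kernel k f \<longleftrightarrow>
     (\<forall>x\<in>tuples k UNIV. \<forall>\<pi>. \<pi> permutes {..<k} \<longrightarrow> f (x \<circ> \<pi>) = f x)"

(* For non-negative kernels only, so that the sum always exists in [0,\<infinity>]. *)
definition U_statistic :: "nat \<Rightarrow> ((nat \<Rightarrow> 'a) \<Rightarrow> real) \<Rightarrow> 'a set \<Rightarrow> ennreal" where
  "U_statistic k f \<xi> = (\<Sum>\<^sub>\<infinity>x\<in>distinct_tuples k \<xi>. ennreal (f x))"

definition is_median :: "'w measure \<Rightarrow> ('w \<Rightarrow> real) \<Rightarrow> real \<Rightarrow> bool" where
  "is_median P Z m \<longleftrightarrow>
     measure P {\<omega>\<in>space P. Z \<omega> \<le> m} \<ge> 1/2 \<and> measure P {\<omega>\<in>space P. Z \<omega> \<ge> m} \<ge> 1/2"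

end

theory Submission
  imports Defs "HOL-Real_Asymp.Real_Asymp"
begin

text \<open>
  Some ball \<open>B\<close> of diameter at most \<open>\<rho>\<close> has finite positive intensity \<open>l\<close>. If it contains exactly
  \<open>k + j\<close> points, then every tuple of distinct points of \<open>B\<close> contributes at least \<open>m\<^sub>F\<close>, so that
  \<open>F \<ge> m\<^sub>F * j ^ k\<close>. This event has the Poisson probability \<open>exp (- l) * l ^ (k + j) / fact (k + j)\<close>,
  hence \<open>I (m\<^sub>F * j ^ k - M)\<close> is \<open>O(j * ln j)\<close>, while by assumption it is at least of order
  \<open>j powr (k * a)\<close>. A non-measurable tail event would have junk measure 0, so it also has to be
  shown that \<open>F\<close> is a random variable; only the point counts are assumed to be.
\<close>

section \<open>Measurability of sums over a random set of points\<close>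

text \<open>For a rectangle \<open>a \<times> b\<close> the sum is the indicator of \<open>a\<close>
  times the point count of \<open>b\<close>, which is measurable by assumption. Rectangles form an
  intersection-stable generator, so closure under complements and disjoint unions gives all
  product-measurable sets.\<close>

lemma borel_measurable_sum_indicator_random_finite_set:
  fixes \<eta> :: "'w \<Rightarrow> 'a::euclidean_space set"
  assumes fin: "\<And>\<omega>. \<omega> \<in> space P \<Longrightarrow> finite (\<eta> \<omega>)"
    and count: "\<And>B. B \<in> sets borel \<Longrightarrow> (\<lambda>\<omega>. point_count (\<eta> \<omega>) B) \<in> borel_measurable P"
    and A: "A \<in> sets (P \<Otimes>\<^sub>M borel)"
  shows "(\<lambda>\<omega>. \<Sum>x\<in>\<eta> \<omega>. (indicator A (\<omega>, x) :: ennreal)) \<in> borel_measurable P"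
proof -
  have point_count_eq: "(\<Sum>x\<in>\<eta> \<omega>. (indicator B x :: ennreal)) = point_count (\<eta> \<omega>) B"
    if "\<omega> \<in> space P" for \<omega> B
    using fin[OF that] by (simp add: point_count_def indicator_def[abs_def] ennreal_of_nat_eq_real_of_nat)
  let ?G = "{a \<times> b | a b. a \<in> sets P \<and> b \<in> sets (borel :: 'a measure)}"
  have "?G \<subseteq> Pow (space P \<times> UNIV)"
    using sets.sets_into_space[of _ P] by auto
  moreover have "A \<in> sigma_sets (space P \<times> UNIV) ?G"
    using A by (simp add: sets_pair_measure)
  ultimately show ?thesis
  proof (induction rule: sigma_sets_induct_disjoint
      [OF Int_stable_pair_measure_generator, consumes 2, case_names basic empty compl union])
    case (basic A)
    then obtain a b where ab: "A = a \<times> b" "a \<in> sets P" "b \<in> sets (borel :: 'a measure)"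
      by auto
    have eq: "(\<Sum>x\<in>\<eta> \<omega>. (indicator A (\<omega>, x) :: ennreal)) = indicator a \<omega> * point_count (\<eta> \<omega>) b"
      if "\<omega> \<in> space P" for \<omega>
      using that by (simp add: ab indicator_times sum_distrib_left[symmetric] point_count_eq)
    have [measurable]: "a \<in> sets P" "(\<lambda>\<omega>. point_count (\<eta> \<omega>) b) \<in> borel_measurable P"
      using ab count by auto
    show ?case
      by (subst measurable_cong[OF eq]) measurable
  next
    case empty
    show ?case by simp
  next
    case (compl A)
    have eq: "(\<Sum>x\<in>\<eta> \<omega>. (indicator (space P \<times> UNIV - A) (\<omega>, x) :: ennreal))
        = point_count (\<eta> \<omega>) UNIV - (\<Sum>x\<in>\<eta> \<omega>. indicator A (\<omega>, x))" if "\<omega> \<in> space P" for \<omega>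
    proof -
      have "point_count (\<eta> \<omega>) UNIV
          = (\<Sum>x\<in>\<eta> \<omega>. (indicator (space P \<times> UNIV - A) (\<omega>, x) :: ennreal) + indicator A (\<omega>, x))"
        unfolding point_count_eq[OF that, symmetric] using that
        by (intro sum.cong) (auto split: split_indicator)
      \<comment> \<open>Subtraction on \<open>ennreal\<close> cancels only finite summands.\<close>
      moreover have "(\<Sum>x\<in>\<eta> \<omega>. (indicator A (\<omega>, x) :: ennreal)) \<noteq> top"
        by (simp add: ennreal_indicator[symmetric] del: ennreal_indicator)
      ultimately show ?thesis
        by (simp add: sum.distrib)
    qed
    have [measurable]: "(\<lambda>\<omega>. \<Sum>x\<in>\<eta> \<omega>. (indicator A (\<omega>, x) :: ennreal)) \<in> borel_measurable P"
        "(\<lambda>\<omega>. point_count (\<eta> \<omega>) UNIV) \<in> borel_measurable P"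
      using compl count by auto
    show ?case
      by (subst measurable_cong[OF eq]) measurable
  next
    case (union A)
    have "(\<Sum>x\<in>\<eta> \<omega>. (indicator (\<Union>i. A i) (\<omega>, x) :: ennreal))
        = (\<Sum>i. \<Sum>x\<in>\<eta> \<omega>. indicator (A i) (\<omega>, x))" for \<omega>
      by (simp add: suminf_indicator[OF union(1), symmetric] suminf_sum)
    then show ?case
      using union(3) by (simp only: borel_measurable_suminf_order)
  qed
qed

text \<open>Indicators extend to non-negative functions by linearity and monotone limits, which
  commute with finite sums. Letting \<open>g\<close> depend on \<open>\<omega>\<close> too allows
  iteration over coordinates: those still fixed become part of the parameter.\<close>

lemma borel_measurable_sum_random_finite_set:
  fixes \<eta> :: "'w \<Rightarrow> 'a::euclidean_space set" and g :: "'w \<times> 'a \<Rightarrow> ennreal"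
  assumes fin: "\<And>\<omega>. \<omega> \<in> space P \<Longrightarrow> finite (\<eta> \<omega>)"
    and count: "\<And>B. B \<in> sets borel \<Longrightarrow> (\<lambda>\<omega>. point_count (\<eta> \<omega>) B) \<in> borel_measurable P"
    and g: "g \<in> borel_measurable (P \<Otimes>\<^sub>M borel)"
  shows "(\<lambda>\<omega>. \<Sum>x\<in>\<eta> \<omega>. g (\<omega>, x)) \<in> borel_measurable P"
  using g
proof (induction rule: borel_measurable_induct)
  case (cong g h)
  have eq: "(\<Sum>x\<in>\<eta> \<omega>. g (\<omega>, x)) = (\<Sum>x\<in>\<eta> \<omega>. h (\<omega>, x))" if "\<omega> \<in> space P" for \<omega>
    using that cong(3) by (intro sum.cong) (auto simp: space_pair_measure)
  show ?case
    by (rule measurable_cong[THEN iffD2, OF _ cong(4)]) (rule eq)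
next
  case (set A)
  show ?case
    by (rule borel_measurable_sum_indicator_random_finite_set[OF fin count set])
next
  case (mult u c)
  then show ?case
    by (simp add: sum_distrib_left[symmetric])
next
  case (add u v)
  then show ?case
    by (simp add: sum.distrib)
next
  case (seq U)
  have "(\<Sum>x\<in>\<eta> \<omega>. (SUP i. U i) (\<omega>, x)) = (SUP i. \<Sum>x\<in>\<eta> \<omega>. U i (\<omega>, x))" for \<omega>
    using seq(3) by (subst ennreal_SUP_sum) (auto simp: image_comp incseq_def le_fun_def)
  moreover have "(\<lambda>\<omega>. SUP i. \<Sum>x\<in>\<eta> \<omega>. U i (\<omega>, x)) \<in> borel_measurable P"
    using seq.IH by measurable
  ultimately show ?case
    by simp
qed

lemma bij_betw_tuples_Suc:
  "bij_betw (\<lambda>(y, x). x(k := y)) (A \<times> tuples k A) (tuples (Suc k) A)"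
  using inj_combinator[of k "{..<k}" "\<lambda>_. A"] PiE_insert_eq[of k "{..<k}" "\<lambda>_. A"]
  by (simp add: bij_betw_def lessThan_Suc)

text \<open>Induction on \<open>k\<close>: the sum over the last coordinate is a measurable function
  of \<open>\<omega>\<close> and the first \<open>k\<close> coordinates, and the induction
  hypothesis handles the remaining sum.\<close>

lemma borel_measurable_sum_tuples_random_finite_set:
  fixes \<eta> :: "'w \<Rightarrow> 'a::euclidean_space set" and g :: "'w \<times> (nat \<Rightarrow> 'a) \<Rightarrow> ennreal"
  assumes fin: "\<And>\<omega>. \<omega> \<in> space P \<Longrightarrow> finite (\<eta> \<omega>)"
    and count: "\<And>B. B \<in> sets borel \<Longrightarrow> (\<lambda>\<omega>. point_count (\<eta> \<omega>) B) \<in> borel_measurable P"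
    and g: "g \<in> borel_measurable (P \<Otimes>\<^sub>M PiM {..<k} (\<lambda>_. borel))"
  shows "(\<lambda>\<omega>. \<Sum>x\<in>tuples k (\<eta> \<omega>). g (\<omega>, x)) \<in> borel_measurable P"
  using g
proof (induction k arbitrary: g)
  case 0
  have "(\<lambda>\<omega>. (\<omega>, \<lambda>_. undefined)) \<in> P \<rightarrow>\<^sub>M P \<Otimes>\<^sub>M PiM {..<0::nat} (\<lambda>_. borel :: 'a measure)"
    by (intro measurable_Pair measurable_ident_sets measurable_const) (auto simp: space_PiM)
  from measurable_compose[OF this 0] show ?case
    by simp
next
  case (Suc k)
  let ?Q = "PiM {..<k} (\<lambda>_. borel :: 'a measure)"
  define h where "h = (\<lambda>(\<omega>, x). \<Sum>y\<in>\<eta> \<omega>. g (\<omega>, x(k := y)))"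
  have upd: "(\<lambda>((\<omega>, x), y). (\<omega>, x(k := y)))
      \<in> (P \<Otimes>\<^sub>M ?Q) \<Otimes>\<^sub>M borel \<rightarrow>\<^sub>M P \<Otimes>\<^sub>M PiM {..<Suc k} (\<lambda>_. borel)"
  proof -
    have "(\<lambda>z. (\<lambda>(f, y). f(k := y)) (snd (fst z), snd z))
        \<in> (P \<Otimes>\<^sub>M ?Q) \<Otimes>\<^sub>M borel \<rightarrow>\<^sub>M PiM (insert k {..<k}) (\<lambda>_. borel :: 'a measure)"
      by (rule measurable_compose[OF _ measurable_add_dim]) simp
    then have "(\<lambda>z. (fst (fst z), (snd (fst z))(k := snd z)))
        \<in> (P \<Otimes>\<^sub>M ?Q) \<Otimes>\<^sub>M borel \<rightarrow>\<^sub>M P \<Otimes>\<^sub>M PiM {..<Suc k} (\<lambda>_. borel)"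
      by (intro measurable_Pair) (simp_all add: lessThan_Suc)
    moreover have "(\<lambda>((\<omega>, x), y). (\<omega>, x(k := y)))
        = (\<lambda>z :: ('w \<times> (nat \<Rightarrow> 'a)) \<times> 'a. (fst (fst z), (snd (fst z))(k := snd z)))"
      by auto
    ultimately show ?thesis
      by simp
  qed
  \<comment> \<open>The one-coordinate lemma is applied with the product
    \<open>P \<Otimes>\<^sub>M ?Q\<close> as parameter space; the random set there ignores the tuple
    component.\<close>
  have "(\<lambda>z. \<Sum>y\<in>\<eta> (fst z). (g \<circ> (\<lambda>((\<omega>, x), y). (\<omega>, x(k := y)))) (z, y))
      \<in> borel_measurable (P \<Otimes>\<^sub>M ?Q)"
  proof (rule borel_measurable_sum_random_finite_set)
    show "(\<lambda>z. point_count (\<eta> (fst z)) B) \<in> borel_measurable (P \<Otimes>\<^sub>M ?Q)"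
      if "B \<in> sets borel" for B
      using measurable_compose[OF measurable_fst count[OF that]] .
    show "g \<circ> (\<lambda>((\<omega>, x), y). (\<omega>, x(k := y))) \<in> borel_measurable ((P \<Otimes>\<^sub>M ?Q) \<Otimes>\<^sub>M borel)"
      using upd Suc.prems by (rule measurable_comp)
  qed (auto simp: space_pair_measure intro: fin)
  then have "h \<in> borel_measurable (P \<Otimes>\<^sub>M ?Q)"
    by (simp add: h_def split_beta)
  then have "(\<lambda>\<omega>. \<Sum>x\<in>tuples k (\<eta> \<omega>). h (\<omega>, x)) \<in> borel_measurable P"
    by (rule Suc.IH)
  also have "(\<lambda>\<omega>. \<Sum>x\<in>tuples k (\<eta> \<omega>). h (\<omega>, x)) = (\<lambda>\<omega>. \<Sum>z\<in>tuples (Suc k) (\<eta> \<omega>). g (\<omega>, z))"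
  proof
    fix \<omega>
    have "(\<Sum>x\<in>tuples k (\<eta> \<omega>). h (\<omega>, x))
        = (\<Sum>y\<in>\<eta> \<omega>. \<Sum>x\<in>tuples k (\<eta> \<omega>). g (\<omega>, x(k := y)))"
      unfolding h_def prod.case by (rule sum.swap)
    also have "\<dots> = (\<Sum>z\<in>\<eta> \<omega> \<times> tuples k (\<eta> \<omega>). g (\<omega>, (\<lambda>(y, x). x(k := y)) z))"
      by (simp add: sum.cartesian_product split_beta)
    also have "\<dots> = (\<Sum>z\<in>tuples (Suc k) (\<eta> \<omega>). g (\<omega>, z))"
      by (rule sum.reindex_bij_betw[OF bij_betw_tuples_Suc])
    finally show "(\<Sum>x\<in>tuples k (\<eta> \<omega>). h (\<omega>, x)) = (\<Sum>z\<in>tuples (Suc k) (\<eta> \<omega>). g (\<omega>, z))" .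
  qed
  finally show ?case .
qed

lemma inj_on_tuples_measurable:
  "Measurable.pred (PiM {..<k} (\<lambda>_. borel :: 'a::euclidean_space measure)) (\<lambda>x. inj_on x {..<k})"
  for k :: nat
proof -
  have [measurable]: "Measurable.pred (PiM {..<k} (\<lambda>_. borel :: 'a measure)) (\<lambda>x. x i = x j)"
    if "i < k" "j < k" for i j
  proof -
    \<comment> \<open>Coincidence of two points is expressed by a vanishing distance, which reduces
      it to an equality of real-valued measurable functions.\<close>
    have "Measurable.pred (PiM {..<k} (\<lambda>_. borel :: 'a measure)) (\<lambda>x. dist (x i) (x j) = 0)"
      unfolding pred_def using that
      by (intro borel_measurable_eq borel_measurable_dist measurable_component_singleton) auto
    then show ?thesis by simp
  qed
  have "Measurable.pred (PiM {..<k} (\<lambda>_. borel :: 'a measure))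
      (\<lambda>x. \<forall>i\<in>{..<k}. \<forall>j\<in>{..<k}. x i = x j \<longrightarrow> i = j)"
    by (intro pred_intros_finite pred_intros_imp' pred_intros_logic finite_lessThan) auto
  then show ?thesis
    by (simp add: inj_on_def)
qed

lemma finite_distinct_tuples: "finite \<xi> \<Longrightarrow> finite (distinct_tuples k \<xi>)"
  unfolding distinct_tuples_def
  by (rule finite_subset[OF Collect_restrict]) (simp add: finite_PiE)

text \<open>A finite set of tuples involves finitely many points, hence lies in some ball, so the
  balls of integer radius exhaust all finite partial sums. An infinite sum over a random index set
  thus becomes a countable supremum of finite sums, which preserves measurability.\<close>

lemma U_statistic_eq_SUP:
  fixes \<xi> :: "'a::euclidean_space set"
  assumes "locally_finite_set \<xi>"
  shows "U_statistic k f \<xi> = (SUP n. \<Sum>x\<in>distinct_tuples k (\<xi> \<inter> ball 0 (real n)). ennreal (f x))"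
proof -
  have fin: "finite (distinct_tuples k (\<xi> \<inter> ball 0 (real n)))" for n
    using assms by (simp add: locally_finite_set_def finite_distinct_tuples)
  have exhaust: "\<exists>n. X \<subseteq> distinct_tuples k (\<xi> \<inter> ball 0 (real n))"
    if X: "finite X" "X \<subseteq> distinct_tuples k \<xi>" for X
  proof -
    have "finite (\<Union>x\<in>X. x ` {..<k})"
      using X by auto
    then obtain r where r: "(\<Union>x\<in>X. x ` {..<k}) \<subseteq> ball 0 r"
      using bounded_subset_ballD[OF finite_imp_bounded] by blast
    obtain n :: nat where "r \<le> real n"
      using real_arch_simple by blast
    then have "ball 0 r \<subseteq> ball (0::'a) (real n)"
      by auto
    then have "X \<subseteq> distinct_tuples k (\<xi> \<inter> ball 0 (real n))"
      using X r by (fastforce simp: distinct_tuples_def PiE_iff)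
    then show ?thesis ..
  qed
  have sub: "distinct_tuples k (\<xi> \<inter> ball 0 (real n)) \<subseteq> distinct_tuples k \<xi>" for n
    by (auto simp: distinct_tuples_def)
  show ?thesis
    unfolding U_statistic_def
  proof (subst nonneg_infsum_complete, simp, rule antisym)
    show "(SUP X\<in>{X. finite X \<and> X \<subseteq> distinct_tuples k \<xi>}. \<Sum>x\<in>X. ennreal (f x))
        \<le> (SUP n. \<Sum>x\<in>distinct_tuples k (\<xi> \<inter> ball 0 (real n)). ennreal (f x))"
    proof (rule SUP_mono)
      fix X assume "X \<in> {X. finite X \<and> X \<subseteq> distinct_tuples k \<xi>}"
      then obtain n where "X \<subseteq> distinct_tuples k (\<xi> \<inter> ball 0 (real n))"
        using exhaust by blast
      then show "\<exists>n\<in>UNIV. (\<Sum>x\<in>X. ennreal (f x))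
          \<le> (\<Sum>x\<in>distinct_tuples k (\<xi> \<inter> ball 0 (real n)). ennreal (f x))"
        using fin by (intro bexI sum_mono2) auto
    qed
    show "(SUP n. \<Sum>x\<in>distinct_tuples k (\<xi> \<inter> ball 0 (real n)). ennreal (f x))
        \<le> (SUP X\<in>{X. finite X \<and> X \<subseteq> distinct_tuples k \<xi>}. \<Sum>x\<in>X. ennreal (f x))"
      using fin sub by (intro SUP_least SUP_upper) auto
  qed
qed

lemma borel_measurable_U_statistic:
  fixes \<eta> :: "'w \<Rightarrow> 'a::euclidean_space set"
  assumes lf: "\<And>\<omega>. \<omega> \<in> space P \<Longrightarrow> locally_finite_set (\<eta> \<omega>)"
    and count: "\<And>B. B \<in> sets borel \<Longrightarrow> (\<lambda>\<omega>. point_count (\<eta> \<omega>) B) \<in> borel_measurable P"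
    and f: "f \<in> borel_measurable (PiM {..<k} (\<lambda>_. borel))"
  shows "(\<lambda>\<omega>. U_statistic k f (\<eta> \<omega>)) \<in> borel_measurable P"
proof -
  let ?\<eta> = "\<lambda>n \<omega>. \<eta> \<omega> \<inter> ball 0 (real n)"
  have fin: "finite (?\<eta> n \<omega>)" if "\<omega> \<in> space P" for n \<omega>
    using lf[OF that] by (simp add: locally_finite_set_def)
  \<comment> \<open>The indicator moves the distinctness condition from the index set into the
    summand, so that the sum runs over all tuples.\<close>
  define g where "g = (\<lambda>(\<omega>::'w, x). ennreal (f x) * indicator {x. inj_on x {..<k}} x)"
  have "(\<lambda>x. ennreal (f x) * indicator {x. inj_on x {..<k}} x)
      \<in> borel_measurable (PiM {..<k} (\<lambda>_. borel))"
    using f inj_on_tuples_measurable by measurable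
  then have g: "g \<in> borel_measurable (P \<Otimes>\<^sub>M PiM {..<k} (\<lambda>_. borel))"
    unfolding g_def split_beta by (rule measurable_compose[OF measurable_snd])
  have "(\<lambda>\<omega>. \<Sum>x\<in>tuples k (?\<eta> n \<omega>). g (\<omega>, x)) \<in> borel_measurable P" for n
  proof (rule borel_measurable_sum_tuples_random_finite_set[OF fin _ g])
    fix B :: "'a set"
    assume "B \<in> sets borel"
    then show "(\<lambda>\<omega>. point_count (?\<eta> n \<omega>) B) \<in> borel_measurable P"
      using count[of "ball 0 (real n) \<inter> B"] by (simp add: point_count_def Int_assoc)
  qed
  then have "(\<lambda>\<omega>. SUP n. \<Sum>x\<in>tuples k (?\<eta> n \<omega>). g (\<omega>, x)) \<in> borel_measurable P"
    by measurable
  moreover have "U_statistic k f (\<eta> \<omega>) = (SUP n. \<Sum>x\<in>tuples k (?\<eta> n \<omega>). g (\<omega>, x))"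
    if "\<omega> \<in> space P" for \<omega>
  proof -
    have "(\<Sum>x\<in>distinct_tuples k (?\<eta> n \<omega>). ennreal (f x)) = (\<Sum>x\<in>tuples k (?\<eta> n \<omega>). g (\<omega>, x))" for n
      using fin[OF that] unfolding distinct_tuples_def g_def
      by (intro sum.mono_neutral_cong_left finite_PiE) auto
    then show ?thesis
      by (simp add: U_statistic_eq_SUP[OF lf[OF that]])
  qed
  ultimately show ?thesis
    by (subst measurable_cong) auto
qed

section \<open>Large values from many points, and a ball of positive intensity\<close>

text \<open>There are \<open>(k + j) * (k + j - 1) * ... * (j + 1)\<close> tuples of distinct points
  of \<open>B\<close>, a product of \<open>k\<close> factors each at least \<open>j\<close>. The
  other tuples of \<open>\<xi>\<close> can only add to the sum.\<close>

lemma U_statistic_ge: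
  fixes \<xi> :: "'a::metric_space set"
  assumes B: "B \<subseteq> \<xi>" "finite B" "card B = k + j"
    and f: "\<And>x. x \<in> tuples k B \<Longrightarrow> m \<le> f x" and "m \<ge> 0"
  shows "U_statistic k f \<xi> \<ge> ennreal (m * real j ^ k)"
proof -
  have fin: "finite (distinct_tuples k B)"
    using B by (simp add: finite_distinct_tuples)
  have "j ^ k = (\<Prod>i\<in>{0..<k}. j)"
    by simp
  also have "\<dots> \<le> (\<Prod>i\<in>{0..<k}. card B - i)"
    using B by (intro prod_mono) auto
  also have "\<dots> = card (distinct_tuples k B)"
    using card_inj_on_subset_funcset[of "{..<k}" B "{..<k}"] B
    by (simp add: distinct_tuples_def)
  finally have "real j ^ k \<le> real (card (distinct_tuples k B))"
    by (metis of_nat_le_iff of_nat_power)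
  then have "ennreal (m * real j ^ k) \<le> ennreal (real (card (distinct_tuples k B)) * m)"
    using \<open>m \<ge> 0\<close> by (intro ennreal_leI) (simp add: mult.commute mult_left_mono)
  also have "\<dots> = (\<Sum>x\<in>distinct_tuples k B. ennreal m)"
    using \<open>m \<ge> 0\<close> by (simp add: ennreal_mult ennreal_of_nat_eq_real_of_nat)
  also have "\<dots> \<le> (\<Sum>x\<in>distinct_tuples k B. ennreal (f x))"
    by (intro sum_mono ennreal_leI f) (auto simp: distinct_tuples_def)
  also have "\<dots> \<le> U_statistic k f \<xi>"
    unfolding U_statistic_def using fin B
    by (subst nonneg_infsum_complete, simp, intro SUP_upper) (auto simp: distinct_tuples_def)
  finally show ?thesis .
qed

text \<open>Balls of radius \<open>r\<close> around a countable dense set cover the space; if all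
  were null, so would be the whole space.\<close>

lemma exists_ball_emeasure_pos:
  fixes \<mu> :: "'a::euclidean_space measure"
  assumes "sets \<mu> = sets borel" "emeasure \<mu> UNIV \<noteq> 0" "r > 0"
  shows "\<exists>z. emeasure \<mu> (ball z r) > 0"
proof (rule ccontr)
  assume "\<not> ?thesis"
  then have null: "ball z r \<in> null_sets \<mu>" for z
    using assms by (auto simp: null_sets_def zero_less_iff_neq_zero)
  obtain D :: "'a set" where D: "countable D" "\<And>X. open X \<Longrightarrow> X \<noteq> {} \<Longrightarrow> \<exists>d\<in>D. d \<in> X"
    using countable_dense_setE by blast
  have "(\<Union>z\<in>D. ball z r) = UNIV"
  proof (intro equalityI subsetI UNIV_I)
    fix x
    obtain d where "d \<in> D" "d \<in> ball x r"
      using D(2)[of "ball x r"] \<open>r > 0\<close> by auto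
    then show "x \<in> (\<Union>z\<in>D. ball z r)"
      by (auto simp: dist_commute)
  qed
  moreover have "(\<Union>z\<in>D. ball z r) \<in> null_sets \<mu>"
    using D(1) null by (rule null_sets_UN')
  ultimately show False
    using assms by (simp add: null_sets_def)
qed

section \<open>Comparison of the Poisson probabilities with the assumed tail bound\<close>

text \<open>Along \<open>r = m * real j ^ k - M\<close>, the liminf condition forces
  \<open>I r\<close> to grow at least like \<open>real j powr (real k * a)\<close>, while the
  logarithm of \<open>tail\<close> bounds it by order \<open>j * ln j\<close>. These conflict once
  \<open>real k * a > 1\<close>.\<close>

lemma Poisson_tail_exponent_le_1:
  fixes I :: "real \<Rightarrow> real"
  assumes "l > 0" "m > 0" "a > 0"
    and tail: "\<And>j. m * real j ^ k \<ge> M \<Longrightarrow>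
      exp (- l) * l ^ (k + j) / fact (k + j) \<le> exp (- I (m * real j ^ k - M))"
    and I: "Liminf at_top (\<lambda>r. ereal (I r / r powr a)) > 0"
    and k: "k \<ge> 1"
  shows "real k * a \<le> 1"
proof (rule ccontr)
  assume "\<not> ?thesis"
  then have ka: "real k * a > 1"
    by simp
  obtain c where c: "c > 0" "\<forall>\<^sub>F r in at_top. ereal c < ereal (I r / r powr a)"
  proof -
    obtain y where y: "0 < y" "y < Liminf at_top (\<lambda>r. ereal (I r / r powr a))"
      using dense[OF I] by blast
    then obtain c where "y = ereal c"
      by (cases y) auto
    then show ?thesis
      using y less_LiminfD[OF y(2)] by (intro that[of c]) auto
  qed
  have top: "LIM j sequentially. m * real j ^ k - M :> at_top"
  proof -
    have "LIM j sequentially. m * real j powr real k - M :> at_top"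
      using \<open>m > 0\<close> k by real_asymp
    moreover have "real j powr real k = real j ^ k" for j
      using k by (simp add: powr_realpow')
    ultimately show ?thesis by simp
  qed
  \<comment> \<open>The numerator of \<open>u\<close> is the bound on \<open>I r\<close> obtained
    below from \<open>tail\<close>; the denominator is the growth forced by the liminf.\<close>
  define u where "u j = (l + real (k + j) * \<bar>ln l\<bar> + real (k + j) * ln (real (k + j)))
      / real j powr (real k * a)" for j
  have "u \<longlonglongrightarrow> 0"
    unfolding u_def of_nat_add using ka k by real_asymp
  moreover have "c * (m / 2) powr a > 0"
    using c \<open>m > 0\<close> by simp
  ultimately have small: "\<forall>\<^sub>F j in sequentially. u j < c * (m / 2) powr a"
    by (rule order_tendstoD)
  \<comment> \<open>Once \<open>m * real j ^ k - M\<close> is at least \<open>M\<close>, half of the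
    main term absorbs the shift by \<open>M\<close>, whatever its sign.\<close>
  have half: "\<forall>\<^sub>F j in sequentially. m / 2 * real j ^ k \<le> m * real j ^ k - M"
    using filterlim_at_top[THEN iffD1, OF top, rule_format, of "M"]
    by eventually_elim (simp add: field_simps)
  \<comment> \<open>The bound \<open>r \<ge> 1\<close> makes \<open>r powr a\<close> positive and
    \<open>tail\<close> applicable; \<open>j > 0\<close> makes the denominator of \<open>u\<close>
    positive.\<close>
  have "\<forall>\<^sub>F j in sequentially. False"
    using small half filterlim_at_top_gt[THEN iffD1, OF top, rule_format, of 0 1, simplified]
      eventually_compose_filterlim[OF c(2) top] eventually_gt_at_top[of 0]
  proof eventually_elim
    case (elim j)
    define r where "r = m * real j ^ k - M"
    have r: "r \<ge> 1" "m / 2 * real j ^ k \<le> r" "c < I r / r powr a"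
      using elim by (auto simp: r_def)
    have kj: "real (k + j) \<ge> 1" "real j > 0"
      using elim by auto
    have "c * (m / 2) powr a * real j powr (real k * a) = c * (m / 2 * real j ^ k) powr a"
      using kj \<open>m > 0\<close> by (simp add: powr_mult[symmetric] powr_powr[symmetric] powr_realpow)
    also have "\<dots> \<le> c * r powr a"
      using r c \<open>m > 0\<close> \<open>a > 0\<close> by (intro mult_left_mono powr_mono2) auto
    also have "\<dots> < I r"
      using r by (simp add: pos_less_divide_eq)
    also have "I r \<le> l - real (k + j) * ln l + ln (fact (k + j))"
    proof -
      have "ln (exp (- l) * l ^ (k + j) / fact (k + j)) \<le> ln (exp (- I r))"
        using tail[of j] r \<open>l > 0\<close> by (intro ln_mono) (auto simp: r_def)
      then show ?thesis
        using \<open>l > 0\<close> by (simp add: ln_mult ln_div ln_realpow)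
    qed
    also have "\<dots> \<le> l + real (k + j) * \<bar>ln l\<bar> + real (k + j) * ln (real (k + j))"
    proof -
      \<comment> \<open>The crude bound \<open>n! \<le> n ^ n\<close> suffices: it costs only order
        \<open>n * ln n\<close>.\<close>
      have "ln (fact (k + j)) \<le> ln (real (k + j) ^ (k + j))"
        using fact_le_power[of "k + j", where 'a = real] kj by (intro ln_mono) auto
      moreover have "- (real (k + j) * ln l) \<le> real (k + j) * \<bar>ln l\<bar>"
        using mult_left_mono[of "- ln l" "\<bar>ln l\<bar>" "real (k + j)"] by simp
      ultimately show ?thesis
        using kj by (simp add: ln_realpow)
    qed
    finally have "c * (m / 2) powr a < u j"
      using kj by (simp add: u_def pos_less_divide_eq)
    then show False
      using elim by simp
  qed
  then show False
    by simp
qed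

section \<open>From a crowded ball to the upper tail of \<open>F\<close>\<close>

theorem proposition3p5:
  fixes P :: "'w measure"
    and \<eta> :: "'w \<Rightarrow> (real ^ 'd) set"
    and \<mu> :: "(real ^ 'd) measure"
    and k :: nat
    and f :: "(nat \<Rightarrow> real ^ 'd) \<Rightarrow> real"
    and F :: "'w \<Rightarrow> real"
    and \<rho> \<Theta> m\<^sub>F M\<^sub>F M a :: real
    and I :: "real \<Rightarrow> real"
  assumes "prob_space P"
    and "poisson_point_process P \<eta> \<mu>"
    and "locally_finite_measure \<mu>"
    and "non_atomic \<mu>"
    and "emeasure \<mu> UNIV \<noteq> 0"
    and "k \<ge> 1"
    and "f \<in> borel_measurable (PiM {..<k} (\<lambda>_. borel))"
    and "symmetric_kernel k f"
    and "\<forall>x\<in>tuples k UNIV. f x \<ge> 0"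
    and "AE \<omega> in P. U_statistic k f (\<eta> \<omega>) < \<infinity>"
    and "F = (\<lambda>\<omega>. enn2real (U_statistic k f (\<eta> \<omega>)))"
    and "\<rho> > 0" and "\<Theta> \<ge> 1" and "m\<^sub>F > 0" and "M\<^sub>F \<ge> m\<^sub>F"
    and K1: "\<forall>x\<in>tuples k UNIV. tuple_diam k x \<le> \<rho> \<longrightarrow> f x > 0"
    and K2: "\<forall>x\<in>tuples k UNIV. tuple_diam k x > \<Theta> * \<rho> \<longrightarrow> f x = 0"
    and K3: "\<forall>x\<in>tuples k UNIV. f x > 0 \<longrightarrow> m\<^sub>F \<le> f x \<and> f x \<le> M\<^sub>F"
    and "M = prob_space.expectation P F \<or> is_median P F M"
    and "a > 0"
    and "\<forall>r\<ge>0. measure P {\<omega>\<in>space P. F \<omega> \<ge> M + r} \<le> exp (- I r)"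
    and "Liminf at_top (\<lambda>r. ereal (I r / r powr a)) > 0"
  shows "a \<le> 1 / real k"
proof -
  interpret prob_space P by fact
  note ppp = assms(2)[unfolded poisson_point_process_def]
  have sets: "sets \<mu> = sets borel"
    and lf: "\<And>\<omega>. \<omega> \<in> space P \<Longrightarrow> locally_finite_set (\<eta> \<omega>)"
    and count: "\<And>B. B \<in> sets borel \<Longrightarrow> (\<lambda>\<omega>. point_count (\<eta> \<omega>) B) \<in> borel_measurable P"
    and Poisson: "\<And>B n. B \<in> sets borel \<Longrightarrow> emeasure \<mu> B < \<infinity> \<Longrightarrow>
        measure P {\<omega>\<in>space P. point_count (\<eta> \<omega>) B = of_nat n}
           = exp (- measure \<mu> B) * measure \<mu> B ^ n / fact n"
    using ppp by auto
  \<comment> \<open>With radius \<open>\<rho> / 2\<close>, any two points of the ball are closer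
    than \<open>\<rho>\<close>, so \<open>K1\<close> makes the kernel positive on all its tuples and
    \<open>K3\<close> raises this to \<open>m\<^sub>F\<close>.\<close>
  obtain z where z: "emeasure \<mu> (ball z (\<rho> / 2)) > 0"
    using exists_ball_emeasure_pos[OF sets assms(5), of "\<rho> / 2"] \<open>\<rho> > 0\<close> by auto
  let ?B = "ball z (\<rho> / 2)"
  have B: "?B \<in> sets borel" "emeasure \<mu> ?B < \<infinity>"
    using assms(3) sets by (auto simp: locally_finite_measure_def)
  define l where "l = measure \<mu> ?B"
  have "l > 0"
    using z B by (simp add: l_def measure_def enn2real_positive_iff)
  have U[measurable]: "(\<lambda>\<omega>. U_statistic k f (\<eta> \<omega>)) \<in> borel_measurable P"
    using borel_measurable_U_statistic[OF lf count assms(7)] .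
  have kernel: "m\<^sub>F \<le> f x" if x: "x \<in> tuples k ?B" for x
  proof -
    have xU: "x \<in> tuples k UNIV"
      using x by auto
    have "tuple_diam k x \<le> \<rho>"
      unfolding tuple_diam_def
    proof (rule diameter_le)
      fix p q assume "p \<in> x ` {..<k}" "q \<in> x ` {..<k}"
      then have "p \<in> ?B" "q \<in> ?B"
        using x PiE_mem[of x "{..<k}" "\<lambda>_. ?B"] by blast+
      then have "dist p q < \<rho>"
        using dist_triangle_half_r[of z p \<rho> q] by simp
      then show "norm (p - q) \<le> \<rho>"
        by (simp add: dist_norm)
    qed (simp add: \<open>\<rho> > 0\<close> less_imp_le)
    then show ?thesis
      using K1 K3 xU by blast
  qed
  have "exp (- l) * l ^ (k + j) / fact (k + j) \<le> exp (- I (m\<^sub>F * real j ^ k - M))"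
    if j: "m\<^sub>F * real j ^ k \<ge> M" for j
  proof -
    have "exp (- l) * l ^ (k + j) / fact (k + j)
        = prob {\<omega>\<in>space P. point_count (\<eta> \<omega>) ?B = of_nat (k + j)}"
      unfolding l_def by (rule Poisson[OF B, symmetric])
    \<comment> \<open>The inclusion of events is claimed only almost surely: where the U-statistic
      is infinite, \<open>enn2real\<close> sets \<open>F\<close> to 0.\<close>
    also have "\<dots> \<le> prob {\<omega>\<in>space P. F \<omega> \<ge> m\<^sub>F * real j ^ k}"
    proof (rule finite_measure_mono_AE)
      show "AE \<omega> in P. \<omega> \<in> {\<omega>\<in>space P. point_count (\<eta> \<omega>) ?B = of_nat (k + j)} \<longrightarrow>
          \<omega> \<in> {\<omega>\<in>space P. F \<omega> \<ge> m\<^sub>F * real j ^ k}"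
        using assms(10)
      proof (rule AE_mp, intro AE_I2 impI)
        fix \<omega>
        assume \<omega>: "\<omega> \<in> space P" "U_statistic k f (\<eta> \<omega>) < \<infinity>"
          and "\<omega> \<in> {\<omega>\<in>space P. point_count (\<eta> \<omega>) ?B = of_nat (k + j)}"
        then have pc: "point_count (\<eta> \<omega>) ?B = of_nat (k + j)"
          by simp
        have fin: "finite (\<eta> \<omega> \<inter> ?B)"
          using lf[OF \<omega>(1)] by (simp add: locally_finite_set_def)
        then have "card (\<eta> \<omega> \<inter> ?B) = k + j"
          using pc unfolding point_count_def
          by (simp del: of_nat_add)
        then have "ennreal (m\<^sub>F * real j ^ k) \<le> U_statistic k f (\<eta> \<omega>)"
          using fin kernel \<open>m\<^sub>F > 0\<close> by (intro U_statistic_ge[of "\<eta> \<omega> \<inter> ?B"]) auto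
        then have "m\<^sub>F * real j ^ k \<le> F \<omega>"
          using \<omega> \<open>m\<^sub>F > 0\<close> enn2real_mono[of "ennreal (m\<^sub>F * real j ^ k)"]
          by (simp add: assms(11))
        then show "\<omega> \<in> {\<omega>\<in>space P. F \<omega> \<ge> m\<^sub>F * real j ^ k}"
          using \<omega> by simp
      qed
      \<comment> \<open>Here the measurability of the U-statistic enters, through \<open>U\<close>:
        monotonicity of the measure requires the larger set to be an event.\<close>
      show "{\<omega>\<in>space P. F \<omega> \<ge> m\<^sub>F * real j ^ k} \<in> events"
        unfolding assms(11) by measurable
    qed
    \<comment> \<open>The tail hypothesis is used at \<open>r = m\<^sub>F * real j ^ k - M\<close>,
      which is non-negative by \<open>j\<close>.\<close>
    also have "\<dots> = prob {\<omega>\<in>space P. F \<omega> \<ge> M + (m\<^sub>F * real j ^ k - M)}"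
      by simp
    also have "\<dots> \<le> exp (- I (m\<^sub>F * real j ^ k - M))"
      using assms(21) j by (metis diff_ge_0_iff_ge)
    finally show ?thesis .
  qed
  then have "real k * a \<le> 1"
    using Poisson_tail_exponent_le_1[OF \<open>l > 0\<close> \<open>m\<^sub>F > 0\<close> \<open>a > 0\<close>] assms(6,22) by blast
  then show ?thesis
    using \<open>k \<ge> 1\<close> by (simp add: field_simps)
qed

end
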